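(* $\mathrm{int}(\mathbb H_\mu)$ is a domain (non-empty connected open set) in $\mathbb C^4$. Moreover, $$\mathrm{int}(\mathbb H_\mu)=\mathbb H\setminus(\{0\}\times\mathbb E)=\{(a,x_1,x_2,x_3)\in\mathbb H: a\neq0\}.$$
   Context: $\mathbb D$ is the open unit disc in $\mathbb C$, $\overline{\mathbb D}$ its closure; $\mathrm{int}(\cdot)$ denotes interior in $\mathbb C^4$; $\|\cdot\|$ is the operator norm on $M_2(\mathbb C)$ induced by the Euclidean norm on $\mathbb C^2$. Let $E\subset M_2(\mathbb C)$ be the linear space of all upper triangular matrices. For $A\in M_2(\mathbb C)$, $$\mu_{\mathrm{hexa}}(A)=\frac{1}{\inf\{\|X\| : X\in E,\ \det(I-AX)=0\}},$$ with $\mu_{\mathrm{hexa}}(A)=0$ if $\det(I-AX)\ne0$ for all $X\in E$. $\pi:M_2(\mathbb C)\to\mathbb C^4$ is $\pi((a_{ij}))=(a_{21},a_{11},a_{22},\det(A))$; $\mathbb H_\mu=\{\pi(A): A\in M_2(\mathbb C),\ \mu_{\mathrm{hexa}}(A)<1\}$. The tetrablock is $\mathbb E=\{(x_1,x_2,x_3)\in\mathbb C^3: 1-x_1z_1-x_2z_2+x_3z_1z_2\ne0 \text{ for all } z_1,z_2\in\overline{\mathbb D}\}$. The hexablock is $$\mathbb H=\left\{(a,x_1,x_2,x_3)\in\mathbb C\times\mathbb E:\ \sup_{z_1,z_2\in\mathbb D}\left|\frac{a\sqrt{(1-|z_1|^2)(1-|z_2|^2)}}{1-x_1z_1-x_2z_2+x_3z_1z_2}\right|<1\right\}.$$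 *)

theory Defs
  imports "HOL-Analysis.Analysis"
begin

text \<open>
  \<open>A $ i $ j\<close> is the entry of \<open>A\<close> in row \<open>i\<close> and column \<open>j\<close>; the norm of the type
  \<open>complex ^ 2\<close> is the Euclidean one. In the index type \<open>2\<close> the numeral \<open>2\<close> equals \<open>0\<close>,
  so \<open>1\<close> and \<open>2\<close> are its two distinct elements.
\<close>

definition upper_triangular2 :: "(complex ^ 2 ^ 2) set" where
  "upper_triangular2 = {X. X $ 2 $ 1 = 0}"

definition matrix_opnorm :: "complex ^ 2 ^ 2 \<Rightarrow> real" where
  "matrix_opnorm X = onorm (\<lambda>v. X *v v)"

text \<open>
  When the set of competing \<open>X\<close> is non-empty, the infimum is positive:
  \<open>det (mat 1 - A ** X) = 0\<close> forces \<open>1 \<le> matrix_opnorm A * matrix_opnorm X\<close>.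
\<close>

definition mu_hexa :: "complex ^ 2 ^ 2 \<Rightarrow> real" where
  "mu_hexa A =
     (if \<forall>X \<in> upper_triangular2. det (mat 1 - A ** X) \<noteq> 0 then 0
      else 1 / Inf {matrix_opnorm X | X. X \<in> upper_triangular2 \<and> det (mat 1 - A ** X) = 0})"

text \<open>
  \<open>\<complex>\<^sup>4\<close> is rendered as \<open>\<complex> \<times> \<complex>\<^sup>3\<close> with its product topology, so that the products
  with the tetrablock are literal ones.
\<close>

type_synonym complex3 = "complex \<times> complex \<times> complex"
type_synonym complex4 = "complex \<times> complex3"

definition hexa_proj :: "complex ^ 2 ^ 2 \<Rightarrow> complex4" where
  "hexa_proj A = (A $ 2 $ 1, A $ 1 $ 1, A $ 2 $ 2, det A)"

definition hexablock_mu :: "complex4 set" where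
  "hexablock_mu = {hexa_proj A | A. mu_hexa A < 1}"

definition tetrablock :: "complex3 set" where
  "tetrablock =
     {(x1, x2, x3). \<forall>z1 \<in> cball 0 1. \<forall>z2 \<in> cball 0 1. 1 - x1 * z1 - x2 * z2 + x3 * z1 * z2 \<noteq> 0}"

text \<open>
  The real-valued supremum below is over a bounded family: for a point of the tetrablock the
  denominator does not vanish on the closed bidisc, hence is bounded away from \<open>0\<close> there.
\<close>

definition hexablock :: "complex4 set" where
  "hexablock =
     {(a, x1, x2, x3). (x1, x2, x3) \<in> tetrablock \<and>
        (SUP (z1, z2) \<in> ball 0 1 \<times> ball 0 1.
           cmod (a * complex_of_real (sqrt ((1 - (cmod z1)\<^sup>2) * (1 - (cmod z2)\<^sup>2)))
                 / (1 - x1 * z1 - x2 * z2 + x3 * z1 * z2))) < 1}"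

end

theory Submission
  imports Defs
begin

text \<open>
  Write \<open>p x z\<close> for the denominator \<open>1 - x1 z1 - x2 z2 + x3 z1 z2\<close> and \<open>s z\<close> for the weight
  \<open>sqrt ((1 - \<bar>z1\<bar>\<^sup>2) (1 - \<bar>z2\<bar>\<^sup>2))\<close>. For an upper triangular \<open>X\<close> with diagonal \<open>z\<close> and
  off-diagonal entry \<open>w\<close>, and with \<open>(a, x)\<close> the projection of \<open>A\<close>, expanding the determinant gives
  \<open>det (1 - A X) = p x z - a w\<close>, while \<open>X\<close> is a contraction exactly if \<open>z\<close> lies in the closed bidisc
  and \<open>\<bar>w\<bar> \<le> s z\<close> (\<open>upper_triangular_contraction_iff\<close>). Letting \<open>w\<close> range over the whole disc of
  radius \<open>s z\<close>, the absence of a contractive root \<open>X\<close> becomes \<open>\<bar>a\<bar> s z < \<bar>p x z\<bar>\<close> on the closed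
  bidisc. By compactness the same condition describes membership in the hexablock
  (\<open>mem_hexablock_iff\<close>), because on the boundary of the bidisc the weight vanishes and the condition
  says only that \<open>p x z \<noteq> 0\<close>. Hence \<open>mu_hexa A < 1\<close> if and only if \<open>A\<close> projects into the hexablock
  (\<open>mu_hexa_less_1_iff\<close>).

  So \<open>hexablock_mu\<close> is the hexablock intersected with the range of the projection. That range
  contains every point with \<open>a \<noteq> 0\<close>, since \<open>A $ 1 $ 2\<close> can then be chosen to give any determinant,
  but for \<open>a = 0\<close> only the points of the hypersurface \<open>x3 = x1 x2\<close>. The hexablock is open
  (\<open>open_hexablock\<close>), so its points with \<open>a \<noteq> 0\<close> are interior; a point with \<open>a = 0\<close> leaves the
  range when \<open>x3\<close> is perturbed and is not interior.

  For connectedness, replacing \<open>(x1, x2, x3)\<close> by \<open>(r x1, r x2, r\<^sup>2 x3)\<close> amounts to evaluating \<open>p x\<close>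
  at \<open>r z\<close>, where the weight is at least as large. This keeps a point in the hexablock with \<open>a\<close> unchanged, and
  as \<open>r\<close> goes to \<open>0\<close> it joins every point with \<open>a \<noteq> 0\<close> to the punctured disc
  \<open>0 < \<bar>a\<bar> < 1\<close>, \<open>x = 0\<close>.
\<close>

section \<open>Contractive upper triangular matrices\<close>

definition hexa_denom :: "complex3 \<Rightarrow> complex \<times> complex \<Rightarrow> complex" where
  "hexa_denom x z = 1 - fst x * fst z - fst (snd x) * snd z + snd (snd x) * fst z * snd z"

definition bidisc_weight :: "complex \<times> complex \<Rightarrow> real" where
  "bidisc_weight z = sqrt ((1 - (cmod (fst z))\<^sup>2) * (1 - (cmod (snd z))\<^sup>2))"

abbreviation closed_bidisc :: "(complex \<times> complex) set" where
  "closed_bidisc \<equiv> cball 0 1 \<times> cball 0 1"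

lemma bidisc_weight_nonneg: "z \<in> closed_bidisc \<Longrightarrow> 0 \<le> bidisc_weight z"
  by (auto simp: bidisc_weight_def power_le_one)

text \<open>
  Multiplying the difference of the two sides by \<open>1 - r\<^sup>2\<close> allows completing the square, which is
  why \<open>r\<^sup>2 = 1\<close> is a separate case. The inequality says that the real matrix with rows \<open>(r, W)\<close> and
  \<open>(0, s)\<close> is a contraction.
\<close>

lemma upper_triangular_real_contraction:
  fixes r s W \<alpha> \<beta> :: real
  assumes r: "r\<^sup>2 \<le> 1" and s: "s\<^sup>2 \<le> 1" and W: "W\<^sup>2 \<le> (1 - r\<^sup>2) * (1 - s\<^sup>2)"
  shows "(r * \<alpha> + W * \<beta>)\<^sup>2 + (s * \<beta>)\<^sup>2 \<le> \<alpha>\<^sup>2 + \<beta>\<^sup>2"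
proof (cases "r\<^sup>2 = 1")
  case True
  then have W0: "W = 0" using W by simp
  have "(s * \<beta>)\<^sup>2 \<le> \<beta>\<^sup>2"
    using mult_right_mono[OF s, of "\<beta>\<^sup>2"] by (simp add: power_mult_distrib)
  then show ?thesis using True W0 by (simp add: power_mult_distrib)
next
  case False
  then have d: "0 < 1 - r\<^sup>2" using r by simp
  have "(1 - r\<^sup>2) * (\<alpha>\<^sup>2 + \<beta>\<^sup>2 - ((r * \<alpha> + W * \<beta>)\<^sup>2 + (s * \<beta>)\<^sup>2))
      = ((1 - r\<^sup>2) * \<alpha> - r * W * \<beta>)\<^sup>2 + ((1 - r\<^sup>2) * (1 - s\<^sup>2) - W\<^sup>2) * \<beta>\<^sup>2"
    by (simp add: power2_eq_square algebra_simps)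
  also have "\<dots> \<ge> 0" using W by simp
  finally show ?thesis using d by (simp add: zero_le_mult_iff)
qed

text \<open>
  Positive semidefiniteness of \<open>1 - X\<^sup>* X\<close>, whose determinant is \<open>(1 - \<bar>z1\<bar>\<^sup>2) (1 - \<bar>z2\<bar>\<^sup>2) - \<bar>w\<bar>\<^sup>2\<close>, expressed
  through the entries \<open>z1, w, z2\<close> of \<open>X\<close>. The necessary conditions come from evaluating
  \<open>\<parallel>X v\<parallel> \<le> \<parallel>v\<parallel>\<close> at single vectors; sufficiency reduces by the triangle inequality to the matrix of
  absolute values.
\<close>

lemma upper_triangular_contraction_iff:
  assumes X: "X \<in> upper_triangular2"
  shows "matrix_opnorm X \<le> 1 \<longleftrightarrow>
    (X $ 1 $ 1, X $ 2 $ 2) \<in> closed_bidisc \<and> cmod (X $ 1 $ 2) \<le> bidisc_weight (X $ 1 $ 1, X $ 2 $ 2)"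
proof -
  obtain z1 w z2 where z: "X $ 1 $ 1 = z1" "X $ 1 $ 2 = w" "X $ 2 $ 2 = z2" by blast
  have X21: "X $ 2 $ 1 = 0" using X by (simp add: upper_triangular2_def)
  have normsq: "(norm v)\<^sup>2 = (cmod (v $ 1))\<^sup>2 + (cmod (v $ 2))\<^sup>2" for v :: "complex ^ 2"
    by (simp add: norm_vec_def L2_set_def sum_2)
  have nX: "(norm (X *v v))\<^sup>2 = (cmod (z1 * v $ 1 + w * v $ 2))\<^sup>2 + (cmod (z2 * v $ 2))\<^sup>2" for v
    by (simp add: normsq matrix_vector_mult_def sum_2 z X21)
  have "matrix_opnorm X \<le> 1 \<longleftrightarrow> (\<forall>v. norm (X *v v) \<le> norm v)"
  proof
    assume le: "matrix_opnorm X \<le> 1"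
    show "\<forall>v. norm (X *v v) \<le> norm v"
    proof
      fix v
      have "norm (X *v v) \<le> matrix_opnorm X * norm v"
        unfolding matrix_opnorm_def by (rule onorm) simp
      also have "\<dots> \<le> 1 * norm v" using le by (intro mult_right_mono) auto
      finally show "norm (X *v v) \<le> norm v" by simp
    qed
  next
    assume "\<forall>v. norm (X *v v) \<le> norm v"
    then show "matrix_opnorm X \<le> 1"
      unfolding matrix_opnorm_def by (intro onorm_le) simp
  qed
  also have "\<dots> \<longleftrightarrow> (\<forall>p q. (cmod (z1 * p + w * q))\<^sup>2 + (cmod (z2 * q))\<^sup>2 \<le> (cmod p)\<^sup>2 + (cmod q)\<^sup>2)"
    (is "_ \<longleftrightarrow> (\<forall>p q. ?Q p q)")
  proof -
    have "norm (X *v v) \<le> norm v \<longleftrightarrow> ?Q (v $ 1) (v $ 2)" for v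
      using nX[of v] normsq[of v] by (metis abs_le_square_iff abs_norm_cancel)
    moreover have "\<exists>v :: complex ^ 2. v $ 1 = p \<and> v $ 2 = q" for p q
      by (rule exI[of _ "vector [p, q]"]) simp
    ultimately show ?thesis by metis
  qed
  also have "\<dots> \<longleftrightarrow> cmod z1 \<le> 1 \<and> cmod z2 \<le> 1 \<and> (cmod w)\<^sup>2 \<le> (1 - (cmod z1)\<^sup>2) * (1 - (cmod z2)\<^sup>2)"
  proof (intro iffI conjI allI)
    assume Q: "\<forall>p q. ?Q p q"
    show z1: "cmod z1 \<le> 1" using Q[rule_format, of 1 0] by (simp add: abs_square_le_1)
    have "(cmod z2)\<^sup>2 \<le> 1"
      using Q[rule_format, of 0 1] by (smt (verit) zero_le_power2 mult_zero_right norm_one mult_1_right add_0 norm_zero power_one zero_power2)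
    then show "cmod z2 \<le> 1" by (simp add: abs_square_le_1)
    define d where "d = 1 - (cmod z1)\<^sup>2"
    have d0: "0 \<le> d" using z1 by (simp add: d_def power_le_one)
    have zz: "z1 * cnj z1 = complex_of_real ((cmod z1)\<^sup>2)"
      by (rule complex_norm_square[symmetric])
    show "(cmod w)\<^sup>2 \<le> (1 - (cmod z1)\<^sup>2) * (1 - (cmod z2)\<^sup>2)"
    proof (cases "d = 0")
      case True
      \<comment> \<open>If \<open>\<bar>z1\<bar> = 1\<close> the first row already has norm \<open>1\<close> without \<open>w\<close>;
        the conjugate of the first row is the vector that detects a non-zero \<open>w\<close>.\<close>
      have "z1 * cnj z1 + w * cnj w = complex_of_real (1 + (cmod w)\<^sup>2)"
        using True by (simp add: d_def zz flip: complex_norm_square)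
      then have "(1 + (cmod w)\<^sup>2)\<^sup>2 + (cmod (z2 * cnj w))\<^sup>2 \<le> (cmod z1)\<^sup>2 + (cmod w)\<^sup>2"
        using Q[rule_format, of "cnj z1" "cnj w"] by (metis complex_mod_cnj norm_of_real power2_abs)
      then have "(1 + (cmod w)\<^sup>2)\<^sup>2 \<le> 1 + (cmod w)\<^sup>2"
        using True d_def zero_le_power2[of "cmod (z2 * cnj w)"] by linarith
      then have "(cmod w)\<^sup>2 + ((cmod w)\<^sup>2)\<^sup>2 \<le> 0" by (simp add: power2_sum)
      then have "(cmod w)\<^sup>2 \<le> 0" using zero_le_power2[of "(cmod w)\<^sup>2"] by linarith
      then show ?thesis using True by (simp add: d_def)
    next
      case False
      \<comment> \<open>The test vector minimises \<open>\<parallel>v\<parallel>\<^sup>2 - \<parallel>X v\<parallel>\<^sup>2\<close> for a fixed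
        second coordinate.\<close>
      have "z1 * (cnj z1 * w) + w * complex_of_real d = w"
        by (simp add: d_def zz flip: mult.assoc) (simp add: algebra_simps)
      then have "(cmod w)\<^sup>2 + (cmod z2)\<^sup>2 * d\<^sup>2 \<le> (cmod z1)\<^sup>2 * (cmod w)\<^sup>2 + d\<^sup>2"
        using Q[rule_format, of "cnj z1 * w" "complex_of_real d"]
        by (simp add: norm_mult power_mult_distrib)
      then have "d * (cmod w)\<^sup>2 \<le> d * (d * (1 - (cmod z2)\<^sup>2))"
        by (simp add: d_def algebra_simps power2_eq_square)
      then show ?thesis using False d0 by (simp add: d_def)
    qed
  next
    fix p q
    assume a: "cmod z1 \<le> 1 \<and> cmod z2 \<le> 1 \<and> (cmod w)\<^sup>2 \<le> (1 - (cmod z1)\<^sup>2) * (1 - (cmod z2)\<^sup>2)"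
    have "cmod (z1 * p + w * q) \<le> cmod z1 * cmod p + cmod w * cmod q"
      by (metis norm_mult norm_triangle_ineq)
    then have "(cmod (z1 * p + w * q))\<^sup>2 \<le> (cmod z1 * cmod p + cmod w * cmod q)\<^sup>2"
      by (simp add: power_mono)
    moreover have "(cmod z1 * cmod p + cmod w * cmod q)\<^sup>2 + (cmod z2 * cmod q)\<^sup>2 \<le> (cmod p)\<^sup>2 + (cmod q)\<^sup>2"
      using a by (intro upper_triangular_real_contraction) (auto simp: power_le_one)
    ultimately show "?Q p q" unfolding norm_mult[of z2] by linarith
  qed
  also have "\<dots> \<longleftrightarrow> (z1, z2) \<in> closed_bidisc \<and> cmod w \<le> bidisc_weight (z1, z2)"
    using real_sqrt_le_iff[of "(cmod w)\<^sup>2" "(1 - (cmod z1)\<^sup>2) * (1 - (cmod z2)\<^sup>2)"]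
    by (auto simp: bidisc_weight_def)
  finally show ?thesis by (simp add: z)
qed

lemma det_one_minus_mult_upper_triangular:
  assumes "X \<in> upper_triangular2"
  shows "det (mat 1 - A ** X) =
    hexa_denom (snd (hexa_proj A)) (X $ 1 $ 1, X $ 2 $ 2) - fst (hexa_proj A) * X $ 1 $ 2"
  using assms
  by (simp add: det_2 matrix_matrix_mult_def mat_def sum_2 hexa_denom_def hexa_proj_def
      upper_triangular2_def algebra_simps)

section \<open>The hexablock as an open set\<close>

lemma mem_tetrablock_iff: "x \<in> tetrablock \<longleftrightarrow> (\<forall>z \<in> closed_bidisc. hexa_denom x z \<noteq> 0)"
  by (cases x) (simp add: tetrablock_def hexa_denom_def)

lemma continuous_on_hexa_denom [continuous_intros]:
  "continuous_on S f \<Longrightarrow> continuous_on S g \<Longrightarrow> continuous_on S (\<lambda>u. hexa_denom (f u) (g u))"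
  unfolding hexa_denom_def by (intro continuous_intros)

lemma continuous_on_bidisc_weight [continuous_intros]:
  "continuous_on S g \<Longrightarrow> continuous_on S (\<lambda>u. bidisc_weight (g u))"
  unfolding bidisc_weight_def by (intro continuous_intros)

lemma compact_closed_bidisc: "compact closed_bidisc"
  by (intro compact_Times compact_cball)

text \<open>
  The supremum over the open bidisc can be replaced by a pointwise strict inequality on the closed
  bidisc: the quotient is continuous there, attains its maximum, and vanishes on the boundary.
  Membership of \<open>snd q\<close> in the tetrablock is contained in the inequality, whose left-hand side is
  non-negative.
\<close>

theorem mem_hexablock_iff:
  "q \<in> hexablock \<longleftrightarrow>
    (\<forall>z \<in> closed_bidisc. cmod (fst q) * bidisc_weight z < cmod (hexa_denom (snd q) z))"
proof -
  obtain a x where q: "q = (a, x)" by (cases q)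
  define f where "f z = cmod a * bidisc_weight z / cmod (hexa_denom x z)" for z
  have f_eq: "f z = cmod (a * complex_of_real (sqrt ((1 - (cmod (fst z))\<^sup>2) * (1 - (cmod (snd z))\<^sup>2)))
      / hexa_denom x z)" if "z \<in> closed_bidisc" for z
    using bidisc_weight_nonneg[OF that] by (simp add: f_def norm_mult norm_divide bidisc_weight_def)
  have hex: "q \<in> hexablock \<longleftrightarrow> x \<in> tetrablock \<and> (SUP z \<in> ball 0 1 \<times> ball 0 1. f z) < 1"
  proof -
    have "(SUP z \<in> ball 0 1 \<times> ball 0 1. f z) = (SUP (z1, z2) \<in> ball 0 1 \<times> ball 0 1.
           cmod (a * complex_of_real (sqrt ((1 - (cmod z1)\<^sup>2) * (1 - (cmod z2)\<^sup>2)))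
                 / hexa_denom x (z1, z2)))"
      by (intro SUP_cong refl) (auto simp: f_eq)
    then show ?thesis
      by (cases x) (simp add: q hexablock_def hexa_denom_def)
  qed
  have f_less: "f z < 1 \<longleftrightarrow> cmod a * bidisc_weight z < cmod (hexa_denom x z)"
    if "hexa_denom x z \<noteq> 0" for z
    using that by (simp add: f_def divide_simps)
  have cont: "continuous_on closed_bidisc f" if "x \<in> tetrablock"
    using that unfolding f_def by (intro continuous_intros) (auto simp: mem_tetrablock_iff)
  have "q \<in> hexablock \<longleftrightarrow> x \<in> tetrablock \<and> (\<forall>z \<in> closed_bidisc. f z < 1)"
  proof (unfold hex, intro conj_cong refl iffI ballI)
    fix z :: "complex \<times> complex"
    assume x: "x \<in> tetrablock" and sup: "(SUP z \<in> ball 0 1 \<times> ball 0 1. f z) < 1"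
      and z: "z \<in> closed_bidisc"
    show "f z < 1"
    proof (cases "z \<in> ball 0 1 \<times> ball 0 1")
      case True
      have "bdd_above (f ` closed_bidisc)"
        using compact_continuous_image[OF cont[OF x] compact_closed_bidisc]
        by (simp add: bounded_imp_bdd_above compact_imp_bounded)
      then have "bdd_above (f ` (ball 0 1 \<times> ball 0 1))"
        by (rule bdd_above_mono) (auto intro!: image_mono)
      from cSUP_upper[OF True this] sup show ?thesis by linarith
    next
      case False
      then have "cmod (fst z) = 1 \<or> cmod (snd z) = 1" using z by (cases z) auto
      then show ?thesis by (auto simp: f_def bidisc_weight_def)
    qed
  next
    assume x: "x \<in> tetrablock" and less: "\<forall>z \<in> closed_bidisc. f z < 1"
    obtain m where m: "m \<in> closed_bidisc" "\<forall>z \<in> closed_bidisc. f z \<le> f m"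
      using continuous_attains_sup[OF compact_closed_bidisc _ cont[OF x]] by auto
    have "(SUP z \<in> ball 0 1 \<times> ball 0 1. f z) \<le> f m"
      using m by (intro cSUP_least) auto
    also have "\<dots> < 1" using less m by blast
    finally show "(SUP z \<in> ball 0 1 \<times> ball 0 1. f z) < 1" .
  qed
  also have "\<dots> \<longleftrightarrow> (\<forall>z \<in> closed_bidisc. cmod a * bidisc_weight z < cmod (hexa_denom x z))"
  proof -
    have "hexa_denom x z \<noteq> 0"
      if "z \<in> closed_bidisc" "cmod a * bidisc_weight z < cmod (hexa_denom x z)" for z
    proof -
      have "0 \<le> cmod a * bidisc_weight z" using bidisc_weight_nonneg[OF that(1)] by simp
      then show ?thesis using that(2) by fastforce
    qed
    then show ?thesis using f_less unfolding mem_tetrablock_iff by blast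
  qed
  finally show ?thesis by (simp add: q)
qed

lemma tetrablock_if_hexablock: "q \<in> hexablock \<Longrightarrow> snd q \<in> tetrablock"
  by (auto simp: hexablock_def)

text \<open>
  The complement is the projection, along the compact closed bidisc, of the closed set on which the
  strict inequality fails.
\<close>

lemma open_hexablock: "open hexablock"
proof -
  let ?T = "{(z, q). cmod (hexa_denom (snd q) z) \<le> cmod (fst q) * bidisc_weight z}"
  have "closed ?T"
    unfolding case_prod_beta by (intro closed_Collect_le continuous_intros)
  from closed_compact_projection[OF compact_closed_bidisc this]
  have "closed {q. \<exists>z. z \<in> closed_bidisc \<and> (z, q) \<in> ?T}" .
  moreover have "- hexablock = {q. \<exists>z. z \<in> closed_bidisc \<and> (z, q) \<in> ?T}"
  proof (rule set_eqI)
    fix q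
    show "q \<in> - hexablock \<longleftrightarrow> q \<in> {q. \<exists>z. z \<in> closed_bidisc \<and> (z, q) \<in> ?T}"
      unfolding Compl_iff mem_hexablock_iff mem_Collect_eq prod.case not_less[symmetric] by blast
  qed
  ultimately show ?thesis by (simp add: open_closed)
qed

section \<open>The structured singular value and the hexablock\<close>

text \<open>
  For fixed diagonal \<open>z\<close>, the products \<open>a w\<close> with \<open>\<bar>w\<bar> \<le> s z\<close> fill the closed disc of radius
  \<open>\<bar>a\<bar> s z\<close>, and \<open>p x z\<close> avoids this disc exactly if its absolute value exceeds the radius.
\<close>

lemma hexa_proj_mem_hexablock_iff:
  "hexa_proj A \<in> hexablock \<longleftrightarrow>
    (\<forall>X \<in> upper_triangular2. matrix_opnorm X \<le> 1 \<longrightarrow> det (mat 1 - A ** X) \<noteq> 0)"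
proof -
  obtain a x where ax: "hexa_proj A = (a, x)" by (cases "hexa_proj A")
  have "(\<forall>X \<in> upper_triangular2. matrix_opnorm X \<le> 1 \<longrightarrow> det (mat 1 - A ** X) \<noteq> 0) \<longleftrightarrow>
    (\<forall>z \<in> closed_bidisc. \<forall>w. cmod w \<le> bidisc_weight z \<longrightarrow> hexa_denom x z \<noteq> a * w)"
    (is "?L \<longleftrightarrow> ?R")
  proof
    assume L: ?L
    show ?R
    proof (intro ballI allI impI)
      fix z :: "complex \<times> complex" and w :: complex
      assume z: "z \<in> closed_bidisc" and w: "cmod w \<le> bidisc_weight z"
      define X :: "complex ^ 2 ^ 2" where "X = vector [vector [fst z, w], vector [0, snd z]]"
      have X: "X $ 1 $ 1 = fst z" "X $ 1 $ 2 = w" "X $ 2 $ 2 = snd z" "X \<in> upper_triangular2"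
        by (simp_all add: X_def upper_triangular2_def)
      then have "matrix_opnorm X \<le> 1"
        using z w upper_triangular_contraction_iff[OF X(4)] by simp
      then have "det (mat 1 - A ** X) \<noteq> 0" using L X(4) by blast
      then show "hexa_denom x z \<noteq> a * w"
        by (simp add: det_one_minus_mult_upper_triangular[OF X(4)] X(1-3) ax)
    qed
  next
    assume R: ?R
    show ?L
    proof (intro ballI impI)
      fix X assume X: "X \<in> upper_triangular2" and n: "matrix_opnorm X \<le> 1"
      show "det (mat 1 - A ** X) \<noteq> 0"
        using R n unfolding upper_triangular_contraction_iff[OF X] det_one_minus_mult_upper_triangular[OF X] ax
        by auto
    qed
  qed
  also have "\<dots> \<longleftrightarrow> (\<forall>z \<in> closed_bidisc. cmod a * bidisc_weight z < cmod (hexa_denom x z))"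
  proof (intro ball_cong refl)
    fix z :: "complex \<times> complex" assume z: "z \<in> closed_bidisc"
    note nonneg = bidisc_weight_nonneg[OF z]
    show "(\<forall>w. cmod w \<le> bidisc_weight z \<longrightarrow> hexa_denom x z \<noteq> a * w) \<longleftrightarrow>
      cmod a * bidisc_weight z < cmod (hexa_denom x z)" (is "?P \<longleftrightarrow> ?N")
    proof
      assume P: ?P
      show ?N
      proof (rule ccontr)
        assume "\<not> ?N"
        then have le: "cmod (hexa_denom x z) \<le> cmod a * bidisc_weight z" by simp
        have "cmod (hexa_denom x z / a) \<le> bidisc_weight z"
          using le nonneg by (cases "a = 0") (simp_all add: norm_divide divide_simps mult.commute)
        with P have "hexa_denom x z \<noteq> a * (hexa_denom x z / a)" by blast
        then have "a = 0" by (cases "a = 0") auto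
        then show False using le \<open>hexa_denom x z \<noteq> a * (hexa_denom x z / a)\<close> by simp
      qed
    next
      assume N: ?N
      show ?P
      proof (intro allI impI notI)
        fix w assume w: "cmod w \<le> bidisc_weight z" and eq: "hexa_denom x z = a * w"
        have "cmod (hexa_denom x z) \<le> cmod a * bidisc_weight z"
          unfolding eq norm_mult using w by (simp add: mult_left_mono)
        then show False using N by simp
      qed
    qed
  qed
  finally show ?thesis by (simp add: mem_hexablock_iff ax)
qed

text \<open>
  \<open>A X = (t A) (X / t)\<close>, so the previous characterisation of contractive roots applies to roots of
  any norm. This bounds the infimum in \<open>mu_hexa\<close> from below by every \<open>t > 0\<close> for which \<open>t A\<close>
  projects into the hexablock.
\<close>

lemma opnorm_gt_if_scaled_mem_hexablock:
  assumes t: "0 < t" and mem: "hexa_proj (t *\<^sub>R A) \<in> hexablock"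
    and X: "X \<in> upper_triangular2" and det: "det (mat 1 - A ** X) = 0"
  shows "t < matrix_opnorm X"
proof (rule ccontr)
  assume "\<not> t < matrix_opnorm X"
  define Y where "Y = (1 / t) *\<^sub>R X"
  have "Y *v v = (1 / t) *\<^sub>R (X *v v)" for v
    by (simp add: Y_def matrix_vector_mult_def vec_eq_iff scaleR_right_distrib sum_2)
  then have "matrix_opnorm Y = matrix_opnorm X / t"
    using t onorm_scaleR[OF matrix_vector_mul_bounded_linear[of X], of "1 / t"]
    by (simp add: matrix_opnorm_def)
  then have "matrix_opnorm Y \<le> 1" using t \<open>\<not> t < matrix_opnorm X\<close> by simp
  moreover have "Y \<in> upper_triangular2" using X by (simp add: Y_def upper_triangular2_def)
  moreover have "(t *\<^sub>R A) ** Y = A ** X"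
    using t by (simp add: Y_def matrix_matrix_mult_def vec_eq_iff sum_2)
  ultimately show False using mem det by (metis hexa_proj_mem_hexablock_iff)
qed

lemma open_scalings_into_hexablock: "open {t. hexa_proj (t *\<^sub>R A) \<in> hexablock}"
proof -
  have "continuous_on UNIV (\<lambda>t. hexa_proj (t *\<^sub>R A))"
    unfolding hexa_proj_def det_2 by (simp, intro continuous_intros)
  from open_vimage[OF open_hexablock this] show ?thesis by (simp add: vimage_def)
qed

lemma zero_scaling_into_hexablock: "hexa_proj (0 *\<^sub>R A) \<in> hexablock"
  by (simp add: mem_hexablock_iff hexa_proj_def hexa_denom_def det_2)

lemma open_real_contains_greater:
  fixes c :: real
  assumes "open S" "c \<in> S"
  shows "\<exists>t > c. t \<in> S"
proof -
  obtain e where e: "0 < e" "\<And>y. dist y c < e \<Longrightarrow> y \<in> S"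
    using assms by (metis open_dist)
  then show ?thesis by (intro exI[of _ "c + e / 2"]) (auto simp: dist_real_def)
qed

text \<open>
  Openness of the hexablock is used at two scalings. Near \<open>0\<close> it gives some \<open>t > 0\<close>, so that the
  infimum is positive and its reciprocal is a genuine one; near \<open>1\<close> it gives some \<open>t > 1\<close>, which
  turns the absence of roots of norm at most \<open>1\<close> into an infimum above \<open>1\<close> without having to know
  that the infimum is attained.
\<close>

theorem mu_hexa_less_1_iff: "mu_hexa A < 1 \<longleftrightarrow> hexa_proj A \<in> hexablock"
proof (cases "\<forall>X \<in> upper_triangular2. det (mat 1 - A ** X) \<noteq> 0")
  case True
  then show ?thesis by (simp add: mu_hexa_def hexa_proj_mem_hexablock_iff)
next
  case False
  define N where "N = {matrix_opnorm X | X. X \<in> upper_triangular2 \<and> det (mat 1 - A ** X) = 0}"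
  have mu: "mu_hexa A = 1 / Inf N" and ne: "N \<noteq> {}"
    using False by (auto simp: mu_hexa_def N_def)
  have Inf_ge: "t \<le> Inf N" if "0 < t" "hexa_proj (t *\<^sub>R A) \<in> hexablock" for t
    using ne opnorm_gt_if_scaled_mem_hexablock[OF that]
    by (intro cInf_greatest) (auto simp: N_def less_imp_le)
  obtain t0 where "0 < t0" "hexa_proj (t0 *\<^sub>R A) \<in> hexablock"
    using open_real_contains_greater[OF open_scalings_into_hexablock] zero_scaling_into_hexablock by blast
  then have Inf_pos: "0 < Inf N" using Inf_ge by fastforce
  have bdd: "bdd_below N"
    by (rule bdd_belowI[of _ 0]) (auto simp: N_def matrix_opnorm_def onorm_pos_le)
  show ?thesis
  proof
    assume "mu_hexa A < 1"
    then have "1 < Inf N" using mu Inf_pos by simp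
    then show "hexa_proj A \<in> hexablock"
      unfolding hexa_proj_mem_hexablock_iff
      using cInf_lower[OF _ bdd] by (fastforce simp: N_def)
  next
    assume "hexa_proj A \<in> hexablock"
    then obtain t where "1 < t" "hexa_proj (t *\<^sub>R A) \<in> hexablock"
      using open_real_contains_greater[OF open_scalings_into_hexablock, of 1 A] by auto
    then have "1 < Inf N" using Inf_ge[of t] by simp
    then show "mu_hexa A < 1" using mu by simp
  qed
qed

section \<open>The interior\<close>

lemma range_hexa_proj: "range hexa_proj = {(a, x1, x2, x3). a \<noteq> 0 \<or> x3 = x1 * x2}"
proof (intro equalityI subsetI)
  fix q assume "q \<in> {(a :: complex, x1 :: complex, x2, x3). a \<noteq> 0 \<or> x3 = x1 * x2}"
  then obtain a x1 x2 x3 where q: "q = (a, x1, x2, x3)" "a \<noteq> 0 \<or> x3 = x1 * x2" by auto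
  then have "q = hexa_proj (vector [vector [x1, (x1 * x2 - x3) / a], vector [a, x2]])"
    by (auto simp: hexa_proj_def det_2)
  then show "q \<in> range hexa_proj" by blast
qed (auto simp: hexa_proj_def det_2)

lemma hexablock_mu_eq:
  "hexablock_mu = hexablock \<inter> {(a, x1, x2, x3). a \<noteq> 0 \<or> x3 = x1 * x2}"
  unfolding range_hexa_proj[symmetric] by (auto simp: hexablock_mu_def mu_hexa_less_1_iff)

lemma open_hexablock_nonzero: "open {q \<in> hexablock. fst q \<noteq> 0}"
proof -
  have "open {q :: complex4. fst q \<noteq> 0}"
    by (intro open_Collect_neq continuous_intros)
  then show ?thesis using open_hexablock by (simp add: open_Int Collect_conj_eq)
qed

lemma interior_hexablock_mu: "interior hexablock_mu = {q \<in> hexablock. fst q \<noteq> 0}"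
proof (rule equalityI)
  show "{q \<in> hexablock. fst q \<noteq> 0} \<subseteq> interior hexablock_mu"
    by (rule interior_maximal[OF _ open_hexablock_nonzero]) (auto simp: hexablock_mu_eq)
next
  show "interior hexablock_mu \<subseteq> {q \<in> hexablock. fst q \<noteq> 0}"
  proof
    fix q assume q: "q \<in> interior hexablock_mu"
    obtain a x1 x2 x3 where q_eq: "q = (a, x1, x2, x3)" by (cases q)
    have "a \<noteq> 0"
    proof
      \<comment> \<open>Moving only \<open>x3\<close> stays near \<open>q\<close> but cannot stay on the hypersurface
        \<open>x3 = x1 x2\<close>.\<close>
      assume a: "a = 0"
      obtain e where e: "0 < e" "ball q e \<subseteq> hexablock_mu" using q by (auto simp: mem_interior)
      have near: "(0, x1, x2, x3 + complex_of_real t) \<in> hexablock_mu" if "0 \<le> t" "t < e" for t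
      proof -
        have "(0, x1, x2, x3 + complex_of_real t) \<in> ball q e"
          using that by (simp add: q_eq a dist_Pair_Pair dist_norm)
        then show ?thesis using e by blast
      qed
      have "x3 = x1 * x2" using near[of 0] e by (simp add: hexablock_mu_eq)
      moreover have "x3 + complex_of_real (e / 2) = x1 * x2"
        using near[of "e / 2"] e by (simp add: hexablock_mu_eq)
      ultimately show False using e by simp
    qed
    moreover have "q \<in> hexablock" using q interior_subset hexablock_mu_eq by blast
    ultimately show "q \<in> {q \<in> hexablock. fst q \<noteq> 0}" by (simp add: q_eq)
  qed
qed

section \<open>Connectedness of the part off the hyperplane\<close>

text \<open>The denominator of the contracted point at \<open>z\<close> is that of the original point at \<open>r z\<close>, and
  the weight does not decrease when \<open>z\<close> is moved towards the origin.\<close>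

lemma hexablock_contract:
  assumes q: "(a, x1, x2, x3) \<in> hexablock" and r: "0 \<le> r" "r \<le> 1"
  shows "(a, r *\<^sub>R x1, r *\<^sub>R x2, r\<^sup>2 *\<^sub>R x3) \<in> hexablock"
  unfolding mem_hexablock_iff
proof
  fix z :: "complex \<times> complex" assume z: "z \<in> closed_bidisc"
  have rz: "r *\<^sub>R z \<in> closed_bidisc"
    using z r by (cases z) (auto simp: mult_le_one)
  have sq: "(cmod (r *\<^sub>R u))\<^sup>2 \<le> (cmod u)\<^sup>2" for u
    using r by (simp add: power_mono mult_left_le_one_le)
  have "bidisc_weight z \<le> bidisc_weight (r *\<^sub>R z)"
    unfolding bidisc_weight_def using z rz sq[of "fst z"] sq[of "snd z"]
    by (cases z) (auto intro!: mult_mono simp: power_le_one simp del: norm_scaleR)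
  then have "cmod a * bidisc_weight z \<le> cmod a * bidisc_weight (r *\<^sub>R z)"
    by (simp add: mult_left_mono)
  also have "\<dots> < cmod (hexa_denom (x1, x2, x3) (r *\<^sub>R z))"
    using q rz unfolding mem_hexablock_iff by auto
  also have "hexa_denom (x1, x2, x3) (r *\<^sub>R z) = hexa_denom (r *\<^sub>R x1, r *\<^sub>R x2, r\<^sup>2 *\<^sub>R x3) z"
    by (simp add: hexa_denom_def power2_eq_square)
  finally show "cmod (fst (a, r *\<^sub>R x1, r *\<^sub>R x2, r\<^sup>2 *\<^sub>R x3)) * bidisc_weight z
      < cmod (hexa_denom (snd (a, r *\<^sub>R x1, r *\<^sub>R x2, r\<^sup>2 *\<^sub>R x3)) z)" by simp
qed

lemma hexablock_over_origin: "(a, 0, 0, 0) \<in> hexablock \<longleftrightarrow> cmod a < 1"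
proof
  assume "(a, 0, 0, 0) \<in> hexablock"
  then have "cmod a * bidisc_weight (0, 0) < cmod (hexa_denom (0, 0, 0) (0, 0))"
    unfolding mem_hexablock_iff by fastforce
  then show "cmod a < 1" by (simp add: bidisc_weight_def hexa_denom_def)
next
  assume a: "cmod a < 1"
  have "cmod a * bidisc_weight z < 1" if z: "z \<in> closed_bidisc" for z
  proof -
    have "bidisc_weight z \<le> 1"
      using z unfolding bidisc_weight_def by (cases z) (auto intro!: mult_le_one simp: power_le_one)
    then have "cmod a * bidisc_weight z \<le> cmod a * 1" by (intro mult_left_mono) auto
    then show ?thesis using a by simp
  qed
  then show "(a, 0, 0, 0) \<in> hexablock" by (simp add: mem_hexablock_iff hexa_denom_def)
qed

lemma connected_hexablock_nonzero: "connected {q \<in> hexablock. fst q \<noteq> 0}" (is "connected ?S")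
proof -
  define D :: "complex4 set" where "D = (\<lambda>a. (a, 0, 0, 0)) ` (ball 0 1 - {0})"
  have "connected D"
    unfolding D_def
    by (intro connected_continuous_image continuous_intros connected_punctured_ball) simp
  moreover have "D \<subseteq> ?S" by (auto simp: D_def hexablock_over_origin)
  ultimately have D_conn: "connected_component ?S p q" if "p \<in> D" "q \<in> D" for p q
    using that by (auto simp: connected_component_def)
  have to_D: "\<exists>p \<in> D. connected_component ?S q p" if q: "q \<in> ?S" for q
  proof -
    obtain a x1 x2 x3 where q_eq: "q = (a, x1, x2, x3)" by (cases q)
    let ?\<gamma> = "\<lambda>r::real. (a, r *\<^sub>R x1, r *\<^sub>R x2, r\<^sup>2 *\<^sub>R x3)"
    have conn: "connected (?\<gamma> ` {0..1})"
      by (intro connected_continuous_image continuous_intros) simp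
    have sub: "?\<gamma> ` {0..1} \<subseteq> ?S" using q hexablock_contract by (auto simp: q_eq)
    have q_mem: "q \<in> ?\<gamma> ` {0..1}" by (rule image_eqI[of _ _ 1]) (auto simp: q_eq)
    have p_mem: "(a, 0, 0, 0) \<in> ?\<gamma> ` {0..1}" by (rule image_eqI[of _ _ 0]) auto
    have "connected_component ?S q (a, 0, 0, 0)"
      unfolding connected_component_def using conn sub q_mem p_mem by (intro exI conjI)
    moreover have "(a, 0, 0, 0) \<in> ?S" using sub p_mem by (rule subsetD)
    ultimately show ?thesis
      by (intro bexI[of _ "(a, 0, 0, 0)"]) (auto simp: D_def hexablock_over_origin)
  qed
  show ?thesis
    unfolding connected_iff_connected_component
  proof (intro ballI)
    fix u v assume "u \<in> ?S" "v \<in> ?S"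
    then obtain p q where p: "p \<in> D" "connected_component ?S u p"
      and q: "q \<in> D" "connected_component ?S v q"
      using to_D by blast
    have "connected_component ?S u q"
      using p(2) D_conn[OF p(1) q(1)] by (rule connected_component_trans)
    then show "connected_component ?S u v"
      using connected_component_sym[OF q(2)] by (rule connected_component_trans)
  qed
qed

theorem proposition5p15:
  shows "open (interior hexablock_mu) \<and> connected (interior hexablock_mu) \<and>
           interior hexablock_mu \<noteq> {} \<and>
         interior hexablock_mu = hexablock - {0} \<times> tetrablock \<and>
         hexablock - {0} \<times> tetrablock = {(a, x1, x2, x3). (a, x1, x2, x3) \<in> hexablock \<and> a \<noteq> 0}"
proof -
  have "hexablock - {0} \<times> tetrablock = {q \<in> hexablock. fst q \<noteq> 0}"
    using tetrablock_if_hexablock by force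
  moreover have "{(a, x1, x2, x3). (a, x1, x2, x3) \<in> hexablock \<and> a \<noteq> 0} = {q \<in> hexablock. fst q \<noteq> 0}"
    by auto
  moreover have "(1 / 2, 0, 0, 0) \<in> {q \<in> hexablock. fst q \<noteq> 0}"
    by (simp add: hexablock_over_origin norm_divide)
  ultimately show ?thesis
    using interior_hexablock_mu connected_hexablock_nonzero by (metis empty_iff open_interior)
qed

end
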